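(* Let $j=\frac{1+\sqrt5}{2}$, let $$\mathcal{D}(x,y,z)=(x+jy)^6+(x-jy)^6+(y+jz)^6+(y-jz)^6+(z+jx)^6+(z-jx)^6-\frac{78+104j}{5}\,(x^2+y^2+z^2)^3,$$ let $$\mathcal{C}(x,y,z)=x(y^5+z^5)+(xyz)^2-x^4yz-2(yz)^3,$$ and let $$A=\begin{pmatrix} j&1&1\\ 0&-\mathrm{i}\sqrt{2+j}&\mathrm{i}\sqrt{2+j}\\ 1&-j&-j\end{pmatrix}.$$ Then, for all (column vectors) $\mathbf{x}\in\mathbb{C}^3$, $$\mathcal{D}(A\mathbf{x})=960\,(9+4\sqrt5)\,\mathcal{C}(\mathbf{x}),$$ and hence $\mathcal{D}(\mathbf{x})=0\iff\mathcal{C}(A^{-1}\mathbf{x})=0$.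
   Context: $\mathcal{D}=0$ is Dye's plane sextic model of Bring's curve and $\mathcal{C}=0$ is the Hulek--Craig plane sextic. Polynomials in three variables are evaluated on vectors $\mathbf{x}=(x,y,z)^T\in\mathbb{C}^3$; $\mathrm{i}=\sqrt{-1}$ and $\sqrt{2+j}$ is the positive real square root. *)

theory Defs
  imports "HOL-Analysis.Analysis"
begin

definition golden :: real
  where "golden = (1 + sqrt 5) / 2"

text \<open>Dye's plane sextic model of Bring's curve.\<close>

definition dye_sextic :: "complex \<Rightarrow> complex \<Rightarrow> complex \<Rightarrow> complex"
  where "dye_sextic x y z =
    (let j = complex_of_real golden in
      (x + j * y) ^ 6 + (x - j * y) ^ 6
      + (y + j * z) ^ 6 + (y - j * z) ^ 6
      + (z + j * x) ^ 6 + (z - j * x) ^ 6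
      - (78 + 104 * j) / 5 * (x\<^sup>2 + y\<^sup>2 + z\<^sup>2) ^ 3)"

text \<open>The Hulek--Craig plane sextic.\<close>

definition hulek_craig_sextic :: "complex \<Rightarrow> complex \<Rightarrow> complex \<Rightarrow> complex"
  where "hulek_craig_sextic x y z =
    x * (y ^ 5 + z ^ 5) + (x * y * z)\<^sup>2 - x ^ 4 * y * z - 2 * (y * z) ^ 3"

definition eval_at :: "(complex \<Rightarrow> complex \<Rightarrow> complex \<Rightarrow> complex) \<Rightarrow> complex ^ 3 \<Rightarrow> complex"
  where "eval_at f v = f (v $ 1) (v $ 2) (v $ 3)"

text \<open>The inner vectors are the rows, so that \<^term>\<open>A *v x\<close> is the usual product
  with a column vector.\<close>

definition transition_matrix :: "complex ^ 3 ^ 3"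
  where "transition_matrix =
    (let j = complex_of_real golden;
         s = complex_of_real (sqrt (2 + golden)) in
      vector [vector [j, 1, 1],
              vector [0, - (\<i> * s), \<i> * s],
              vector [1, - j, - j]])"

end

theory Submission
  imports Defs
begin

text \<open>Dye's sextic is a cubic in the squares of its arguments. With \<open>u = y + z\<close> and
  \<open>q = (z - y)\<^sup>2\<close>, the squares of the coordinates of \<open>A x\<close> are polynomials in \<open>x, u, q\<close> over
  \<open>\<rat>(j)\<close>: the radical \<open>\<i> \<surd>(2 + j)\<close> enters only through its square \<open>- (2 + j)\<close>. The Hulek--Craig
  sextic, being symmetric in \<open>y\<close> and \<open>z\<close>, is also a polynomial in \<open>x, u, q\<close>, so the claim becomes a
  polynomial identity modulo \<open>j\<^sup>2 = j + 1\<close>, with \<open>9 + 4 \<surd>5 = 5 + 8 j\<close>.\<close>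

text \<open>The odd powers of \<open>b\<close> cancel, so what remains is a cubic form in
  \<open>a\<^sup>2\<close> and \<open>b\<^sup>2\<close>.\<close>

lemma sum_pow6_even:
  fixes a b :: "'a :: idom"
  shows "(a + b) ^ 6 + (a - b) ^ 6
    = 2 * ((a\<^sup>2) ^ 3 + 15 * (a\<^sup>2)\<^sup>2 * b\<^sup>2 + 15 * a\<^sup>2 * (b\<^sup>2)\<^sup>2 + (b\<^sup>2) ^ 3)"
  by algebra

lemma dye_sextic_substitution:
  fixes j w x y z :: complex
  assumes j: "j\<^sup>2 = j + 1" and w: "w\<^sup>2 = - (2 + j)"
  defines "X \<equiv> j * x + y + z" and "Y \<equiv> w * z - w * y" and "Z \<equiv> x - j * y - j * z"
  shows "(X + j * Y) ^ 6 + (X - j * Y) ^ 6 + (Y + j * Z) ^ 6 + (Y - j * Z) ^ 6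
      + (Z + j * X) ^ 6 + (Z - j * X) ^ 6 - (78 + 104 * j) / 5 * (X\<^sup>2 + Y\<^sup>2 + Z\<^sup>2) ^ 3
    = 960 * (5 + 8 * j) * (x * (y ^ 5 + z ^ 5) + (x * y * z)\<^sup>2 - x ^ 4 * y * z - 2 * (y * z) ^ 3)"
proof -
  define u q where "u = y + z" and "q = (z - y)\<^sup>2"
  define P Q R where "P = (j + 1) * x\<^sup>2 + 2 * j * (x * u) + u\<^sup>2" and "Q = - (2 + j) * q"
    and "R = x\<^sup>2 - 2 * j * (x * u) + (j + 1) * u\<^sup>2"
  have P: "X\<^sup>2 = P" and R: "Z\<^sup>2 = R"
    unfolding X_def Z_def P_def R_def u_def using j by algebra+
  have Q: "Y\<^sup>2 = Q"
    unfolding Y_def Q_def q_def using w by algebra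
  \<comment> \<open>Put \<open>d = z - y\<close>, so that \<open>d\<^sup>2 = q\<close>. Then
    \<open>4 * y * z = u\<^sup>2 - q\<close>, and \<open>y, z = (u \<mp> d) / 2\<close> turns
    \<open>y ^ 5 + z ^ 5\<close> into
    \<open>(u ^ 5 + 10 * u ^ 3 * q + 5 * u * q\<^sup>2) / 16\<close>; 32 is a common
    denominator.\<close>
  have C: "x * (y ^ 5 + z ^ 5) + (x * y * z)\<^sup>2 - x ^ 4 * y * z - 2 * (y * z) ^ 3
    = (2 * x * (u ^ 5 + 10 * u ^ 3 * q + 5 * u * q\<^sup>2) + 2 * x\<^sup>2 * (u\<^sup>2 - q)\<^sup>2
      - 8 * x ^ 4 * (u\<^sup>2 - q) - (u\<^sup>2 - q) ^ 3) / 32"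
    unfolding u_def q_def by algebra
  \<comment> \<open>The factor 5 clears the denominator of Dye's coefficient, and
    \<open>150 = 5 * 960 / 32\<close>.\<close>
  have "5 * (2 * (P ^ 3 + 15 * P\<^sup>2 * (j\<^sup>2 * Q) + 15 * P * (j\<^sup>2 * Q)\<^sup>2 + (j\<^sup>2 * Q) ^ 3)
      + 2 * (Q ^ 3 + 15 * Q\<^sup>2 * (j\<^sup>2 * R) + 15 * Q * (j\<^sup>2 * R)\<^sup>2 + (j\<^sup>2 * R) ^ 3)
      + 2 * (R ^ 3 + 15 * R\<^sup>2 * (j\<^sup>2 * P) + 15 * R * (j\<^sup>2 * P)\<^sup>2 + (j\<^sup>2 * P) ^ 3))
      - (78 + 104 * j) * (P + Q + R) ^ 3
    = 150 * (5 + 8 * j) * (2 * x * (u ^ 5 + 10 * u ^ 3 * q + 5 * u * q\<^sup>2) + 2 * x\<^sup>2 * (u\<^sup>2 - q)\<^sup>2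
      - 8 * x ^ 4 * (u\<^sup>2 - q) - (u\<^sup>2 - q) ^ 3)"
    unfolding P_def Q_def R_def using j by algebra
  moreover have
    "(X + j * Y) ^ 6 + (X - j * Y) ^ 6
      = 2 * (P ^ 3 + 15 * P\<^sup>2 * (j\<^sup>2 * Q) + 15 * P * (j\<^sup>2 * Q)\<^sup>2 + (j\<^sup>2 * Q) ^ 3)"
    "(Y + j * Z) ^ 6 + (Y - j * Z) ^ 6
      = 2 * (Q ^ 3 + 15 * Q\<^sup>2 * (j\<^sup>2 * R) + 15 * Q * (j\<^sup>2 * R)\<^sup>2 + (j\<^sup>2 * R) ^ 3)"
    "(Z + j * X) ^ 6 + (Z - j * X) ^ 6
      = 2 * (R ^ 3 + 15 * R\<^sup>2 * (j\<^sup>2 * P) + 15 * R * (j\<^sup>2 * P)\<^sup>2 + (j\<^sup>2 * P) ^ 3)"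
    by (simp_all only: sum_pow6_even power_mult_distrib [of j _ 2] P Q R)
  \<comment> \<open>With the sixth powers and the cube as opaque variables, restoring the
    denominators is a small identity; no sextic is expanded again.\<close>
  moreover have "a + b + c + d + e + f - m / 5 * t = 960 * n * (k / 32)"
    if "5 * (A + B + C) - m * t = 150 * n * k" "a + b = A" "c + d = B" "e + f = C"
    for a b c d e f A B C m t n k :: complex
    using that by algebra
  ultimately show ?thesis
    unfolding C P Q R by blast
qed

text \<open>Brings the coordinates into the shape of \<open>X\<close>, \<open>Y\<close>,
  \<open>Z\<close> in \<open>dye_sextic_substitution\<close>, with the radical collected in
  \<open>w\<close>.\<close>

lemma transition_matrix_mult:
  fixes v :: "complex ^ 3"
  defines "j \<equiv> complex_of_real golden" and "w \<equiv> \<i> * complex_of_real (sqrt (2 + golden))"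
  shows "(transition_matrix *v v) $ 1 = j * v $ 1 + v $ 2 + v $ 3"
    and "(transition_matrix *v v) $ 2 = w * v $ 3 - w * v $ 2"
    and "(transition_matrix *v v) $ 3 = v $ 1 - j * v $ 2 - j * v $ 3"
  unfolding j_def w_def
  by (simp_all add: transition_matrix_def matrix_vector_mult_def sum_3 Let_def)

lemma golden_pos: "golden > 0"
  by (simp add: golden_def add_pos_pos)

lemma golden_power2: "(complex_of_real golden)\<^sup>2 = complex_of_real golden + 1"
proof -
  have "golden\<^sup>2 = golden + 1"
    by (simp add: golden_def power2_eq_square field_simps)
  then show ?thesis
    by (metis of_real_1 of_real_add of_real_power)
qed

lemma eval_dye_sextic_transition:
  fixes v :: "complex ^ 3"
  shows "eval_at dye_sextic (transition_matrix *v v)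
    = complex_of_real (960 * (9 + 4 * sqrt 5)) * eval_at hulek_craig_sextic v"
proof -
  have "(\<i> * complex_of_real (sqrt (2 + golden)))\<^sup>2 = - (2 + complex_of_real golden)"
    using golden_pos by (simp add: power_mult_distrib flip: of_real_power)
  note sub = dye_sextic_substitution [OF golden_power2 this, of "v $ 1" "v $ 2" "v $ 3"]
  have "9 + 4 * sqrt 5 = 5 + 8 * golden"
    by (simp add: golden_def)
  then show ?thesis
    unfolding eval_at_def dye_sextic_def hulek_craig_sextic_def transition_matrix_mult Let_def
    by (simp only: sub) simp
qed

text \<open>The determinant is a product of factors that are nonzero because \<open>golden\<close>
  is positive.\<close>

lemma invertible_transition_matrix: "invertible transition_matrix"
proof -
  let ?j = "complex_of_real golden" and ?s = "complex_of_real (sqrt (2 + golden))"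
  have "det transition_matrix = 2 * \<i> * ?s * (?j\<^sup>2 + 1)"
    by (simp add: transition_matrix_def det_3 Let_def power2_eq_square algebra_simps)
  \<comment> \<open>Written as the embedding of one real number, the last factor is nonzero by
    positivity over the reals.\<close>
  also have "\<dots> = 2 * \<i> * ?s * complex_of_real (golden + 2)"
    by (simp add: golden_power2)
  also have "\<dots> \<noteq> 0"
    using golden_pos by (simp del: of_real_add)
  finally show ?thesis
    by (simp add: invertible_det_nz)
qed

theorem theorem1:
  shows "(\<forall>x :: complex ^ 3.
            eval_at dye_sextic (transition_matrix *v x)
              = complex_of_real (960 * (9 + 4 * sqrt 5)) * eval_at hulek_craig_sextic x)
       \<and> invertible transition_matrix
       \<and> (\<forall>x :: complex ^ 3.
            eval_at dye_sextic x = 0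
              \<longleftrightarrow> eval_at hulek_craig_sextic (matrix_inv transition_matrix *v x) = 0)"
proof (intro conjI allI)
  fix x :: "complex ^ 3"
  let ?y = "matrix_inv transition_matrix *v x"
  \<comment> \<open>\<open>matrix_inv\<close> is a Hilbert choice; invertibility supplies the
    witness that makes it an actual inverse.\<close>
  have "transition_matrix ** matrix_inv transition_matrix = mat 1"
    using invertible_transition_matrix unfolding invertible_def matrix_inv_def
    by (rule someI2_ex) simp
  then have "transition_matrix *v ?y = x"
    by (simp add: matrix_vector_mul_assoc)
  then have "eval_at dye_sextic x
      = complex_of_real (960 * (9 + 4 * sqrt 5)) * eval_at hulek_craig_sextic ?y"
    using eval_dye_sextic_transition [of ?y] by simp
  moreover have "960 * (9 + 4 * sqrt 5) > 0"
    by (simp add: add_pos_pos)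
  then have "complex_of_real (960 * (9 + 4 * sqrt 5)) \<noteq> 0"
    unfolding of_real_eq_0_iff by linarith
  ultimately show "eval_at dye_sextic x = 0 \<longleftrightarrow> eval_at hulek_craig_sextic ?y = 0"
    by (simp only: mult_eq_0_iff) simp
qed (rule eval_dye_sextic_transition invertible_transition_matrix)+

end
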